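(* Let $\alpha \geq 0.28866$. Then every digraph $G$ on $n \ge 1$ vertices (without loops or parallel arcs) in which every vertex has outdegree at least $\alpha n$ contains a directed cycle of length at most $4$.
   Context: A digraph here has no loops and no parallel arcs, i.e. at most one arc $(u,v)$ for each ordered pair of distinct vertices; the two arcs $(u,v)$ and $(v,u)$ may both be present, and they form a directed cycle of length $2$. *)

theory Defs
  imports Complex_Main
begin

text \<open>A digraph: a finite vertex set V and an arc set E \<subseteq> V \<times> V without loops.
Parallel arcs are excluded automatically since E is a set of ordered pairs.\<close>
definition digraph :: "'a set \<Rightarrow> ('a \<times> 'a) set \<Rightarrow> bool" where
  "digraph V E \<longleftrightarrow> finite V \<and> E \<subseteq> V \<times> V \<and> (\<forall>v. (v, v) \<notin> E)"

definition outdeg :: "('a \<times> 'a) set \<Rightarrow> 'a \<Rightarrow> nat" where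
  "outdeg E v = card {w. (v, w) \<in> E}"

definition is_dicycle :: "'a set \<Rightarrow> ('a \<times> 'a) set \<Rightarrow> 'a list \<Rightarrow> bool" where
  "is_dicycle V E cs \<longleftrightarrow> cs \<noteq> [] \<and> distinct cs \<and> set cs \<subseteq> V \<and>
     (\<forall>i < length cs. (cs ! i, cs ! ((i + 1) mod length cs)) \<in> E)"

end

theory Submission
  imports Defs "HOL-Analysis.Convex"
begin

text \<open>
  In a counterexample with as few vertices as possible we may assume that all outdegrees equal some
  \<open>r \<ge> \<alpha>n\<close>. Minimality makes out-neighbourhoods grow: every nonempty proper vertex set \<open>S\<close> contains a
  vertex with fewer than \<open>\<alpha>|S|\<close> out-neighbours in \<open>S\<close>, so \<open>|S \<union> N\<^sup>+(S)| \<ge> r + (1 - \<alpha>)|S|\<close>.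
  Fix an arc \<open>(u, v)\<close> and let \<open>T = N\<^sup>+(u) \<inter> N\<^sup>+(v)\<close>, \<open>t = |T|\<close>. As there are no short cycles, the
  vertices at distance at most 2 from \<open>T\<close> (at most 1 from \<open>N\<^sup>+(v)\<close>, if \<open>T\<close> is empty) avoid
  \<open>N\<^sup>-(u) \<union> N\<^sup>-(v)\<close>, and the growth bound gives \<open>n \<ge> r(2 - \<alpha>) + (1 - \<alpha>)\<^sup>2 t + |N\<^sup>-(v)| + |N\<^sup>-(u) - N\<^sup>-(v)|\<close>.
  Summed over all arcs, the last term counts the induced paths with two arcs, which, grouped by
  their first arc, number \<open>\<Sum>(r - t)\<close>. Since \<open>\<Sum>t \<le> nr\<^sup>2/2\<close>, this yields
  \<open>n \<ge> r(4 - 2\<alpha> + \<alpha>\<^sup>2/2)\<close>, which fails for \<open>\<alpha> = 0.28866\<close>.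
\<close>

section \<open>Short cycles as closed walks\<close>

definition no_short_cycle :: "('a \<times> 'a) set \<Rightarrow> bool" where
  "no_short_cycle E \<longleftrightarrow> (\<forall>k\<in>{1..4}. \<forall>x. (x, x) \<notin> E ^^ k)"

text \<open>Closed walks replace cycles because they carry no distinctness condition: in this
  first-order form \<open>blast\<close> can refute any short closed walk.\<close>

lemma no_short_cycle_iff:
  "no_short_cycle E \<longleftrightarrow>
     (\<forall>a. (a, a) \<notin> E) \<and>
     (\<forall>a b. (a, b) \<in> E \<longrightarrow> (b, a) \<notin> E) \<and>
     (\<forall>a b c. (a, b) \<in> E \<longrightarrow> (b, c) \<in> E \<longrightarrow> (c, a) \<notin> E) \<and>
     (\<forall>a b c d. (a, b) \<in> E \<longrightarrow> (b, c) \<in> E \<longrightarrow> (c, d) \<in> E \<longrightarrow> (d, a) \<notin> E)"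
proof -
  have "{1..4::nat} = {1, 2, 3, 4}" by auto
  then show ?thesis
    unfolding no_short_cycle_def by (simp add: numeral_eq_Suc relcomp_unfold) blast
qed

lemma no_short_cycle_mono: "no_short_cycle E \<Longrightarrow> F \<subseteq> E \<Longrightarrow> no_short_cycle F"
  unfolding no_short_cycle_iff by blast

lemma no_short_cycleI:
  assumes "digraph V E" and no: "\<nexists>cs. is_dicycle V E cs \<and> length cs \<le> 4"
  shows "no_short_cycle E"
proof -
  have EV: "a \<in> V \<and> b \<in> V" if "(a, b) \<in> E" for a b
    using assms(1) that unfolding digraph_def by blast
  have E1: "(a, a) \<notin> E" for a
    using assms(1) unfolding digraph_def by blast
  have E2: "(b, a) \<notin> E" if "(a, b) \<in> E" for a b
  proof
    assume "(b, a) \<in> E"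
    with that E1 EV have "is_dicycle V E [a, b]"
      unfolding is_dicycle_def by (auto simp: less_Suc_eq)
    with no show False by force
  qed
  have E3: "(c, a) \<notin> E" if "(a, b) \<in> E" "(b, c) \<in> E" for a b c
  proof
    assume "(c, a) \<in> E"
    with that E1 EV have "is_dicycle V E [a, b, c]"
      unfolding is_dicycle_def by (auto simp: less_Suc_eq)
    with no show False by force
  qed
  have E4: "(d, a) \<notin> E" if "(a, b) \<in> E" "(b, c) \<in> E" "(c, d) \<in> E" for a b c d
  proof
    assume "(d, a) \<in> E"
    \<comment> \<open>A repeated vertex would split the closed walk into two 2-cycles.\<close>
    moreover from this that E2 have "a \<noteq> c" "b \<noteq> d" by blast+
    ultimately have "is_dicycle V E [a, b, c, d]"
      using that E1 EV unfolding is_dicycle_def by (auto simp: less_Suc_eq)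
    with no show False by force
  qed
  show ?thesis
    unfolding no_short_cycle_iff using E1 E2 E3 E4 by blast
qed

section \<open>Regular digraphs with sparse proper subsets\<close>

locale regular_short_cycle_free =
  fixes V :: "'a set" and E :: "('a \<times> 'a) set" and r :: nat and \<alpha> :: real
  assumes finite_V: "finite V"
    and E_subset: "E \<subseteq> V \<times> V"
    and short_free: "no_short_cycle E"
    and out_card: "v \<in> V \<Longrightarrow> card (E `` {v}) = r"
    and sparse: "S \<subset> V \<Longrightarrow> S \<noteq> {} \<Longrightarrow> \<exists>x\<in>S. real (card (E `` {x} \<inter> S)) \<le> \<alpha> * real (card S)"
    and r_pos: "0 < r"
    and alpha_le_1: "\<alpha> \<le> 1"
begin

abbreviation out_nbrs :: "'a \<Rightarrow> 'a set" where "out_nbrs v \<equiv> E `` {v}"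

abbreviation in_nbrs :: "'a \<Rightarrow> 'a set" where "in_nbrs v \<equiv> E\<inverse> `` {v}"

abbreviation common_out :: "'a \<Rightarrow> 'a \<Rightarrow> nat" where
  "common_out u v \<equiv> card (out_nbrs u \<inter> out_nbrs v)"

lemma out_nbrs_subset: "out_nbrs v \<subseteq> V" and in_nbrs_subset: "in_nbrs v \<subseteq> V"
  using E_subset by blast+

lemma finite_out_nbrs [simp]: "finite (out_nbrs v)"
  and finite_in_nbrs [simp]: "finite (in_nbrs v)"
  by (rule finite_subset[OF _ finite_V], use E_subset in blast)+

lemma finite_E [simp]: "finite E"
  using finite_subset[OF E_subset] finite_V by simp

lemma E_eq_Sigma: "E = (SIGMA v:V. out_nbrs v)"
  using E_subset by blast

lemma converse_E_eq_Sigma: "E\<inverse> = (SIGMA v:V. in_nbrs v)"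
  using E_subset by blast

lemma sum_E: "(\<Sum>(u, v)\<in>E. f u v) = (\<Sum>u\<in>V. \<Sum>v\<in>out_nbrs u. f u v)"
  by (subst sum.Sigma) (simp_all add: finite_V flip: E_eq_Sigma)

lemma sum_converse_E: "(\<Sum>(u, v)\<in>E. f u v) = (\<Sum>v\<in>V. \<Sum>u\<in>in_nbrs v. f u v)"
proof -
  have "(\<Sum>(u, v)\<in>E. f u v) = (\<Sum>(v, u)\<in>E\<inverse>. f u v)"
    by (rule sum.reindex_bij_witness[of _ prod.swap prod.swap]) auto
  also have "\<dots> = (\<Sum>v\<in>V. \<Sum>u\<in>in_nbrs v. f u v)"
    by (subst sum.Sigma) (simp_all add: finite_V flip: converse_E_eq_Sigma)
  finally show ?thesis .
qed

lemma card_E: "card E = r * card V"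
  using sum_E[of "\<lambda>_ _. 1::nat"] out_card by simp

text \<open>A sparse vertex of \<open>S\<close> sends at least r - \<alpha>|S| of its r arcs out of
  \<open>S\<close>; their heads are added to \<open>S\<close>.\<close>

lemma growth:
  assumes "S \<subset> V" "S \<noteq> {}"
  shows "real r + (1 - \<alpha>) * real (card S) \<le> real (card (S \<union> E `` S))"
proof -
  have fin: "finite S" "finite (E `` S)"
    using assms(1) E_subset finite_V by (auto intro: finite_subset[OF _ finite_V])
  obtain x where x: "x \<in> S" "real (card (out_nbrs x \<inter> S)) \<le> \<alpha> * real (card S)"
    using sparse[OF assms] by blast
  have "card (out_nbrs x \<union> S) + card (out_nbrs x \<inter> S) = r + card S"
    using card_Un_Int[of "out_nbrs x" S] out_card[of x] x(1) assms(1) fin(1)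
    by (simp add: psubset_eq subset_iff)
  moreover have "card (out_nbrs x \<union> S) \<le> card (S \<union> E `` S)"
    using fin x(1) by (intro card_mono) auto
  ultimately have "real r + real (card S) - real (card (out_nbrs x \<inter> S)) \<le> real (card (S \<union> E `` S))"
    by linarith
  then show ?thesis
    using x(2) by (simp add: left_diff_distrib)
qed

lemma growth_twice:
  assumes "S \<subset> V" "S \<noteq> {}" and S': "S' = S \<union> E `` S" and "S' \<subset> V"
  shows "real r * (2 - \<alpha>) + (1 - \<alpha>)\<^sup>2 * real (card S) \<le> real (card (S' \<union> E `` S'))"
proof -
  have "(1 - \<alpha>) * (real r + (1 - \<alpha>) * real (card S)) \<le> (1 - \<alpha>) * real (card S')"
    using growth[OF assms(1,2)] alpha_le_1 unfolding S' by (intro mult_left_mono) auto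
  moreover have "real r + (1 - \<alpha>) * real (card S') \<le> real (card (S' \<union> E `` S'))"
    using assms by (intro growth) auto
  ultimately show ?thesis
    by (simp add: algebra_simps power2_eq_square)
qed

lemma arc_bound:
  assumes uv: "(u, v) \<in> E"
  shows "real r * (2 - \<alpha>) + (1 - \<alpha>)\<^sup>2 * real (common_out u v)
           + real (card (in_nbrs v)) + real (card (in_nbrs u - in_nbrs v)) \<le> real (card V)"
proof -
  have uvV: "u \<in> V" "v \<in> V" using uv E_subset by auto
  let ?I = "in_nbrs u \<union> in_nbrs v"
  have cI: "card ?I = card (in_nbrs v) + card (in_nbrs u - in_nbrs v)"
    by (subst card_Un_disjoint[symmetric]) (auto intro: arg_cong[where f = card])
  obtain Z where Z: "Z \<subseteq> V" "Z \<inter> ?I = {}"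
    "real r * (2 - \<alpha>) + (1 - \<alpha>)\<^sup>2 * real (common_out u v) \<le> real (card Z)"
  proof (cases "out_nbrs u \<inter> out_nbrs v = {}")
    \<comment> \<open>Growth needs a nonempty start. Here the target is only r(2 - \<alpha>) = r +
      (1 - \<alpha>)r, which one growth step from the r out-neighbours of \<open>v\<close> provides.
      An arc from \<open>?Z\<close> to \<open>u\<close> or \<open>v\<close> would close a walk of
      length at most 4 through \<open>v\<close>.\<close>
    case True
    let ?S = "out_nbrs v"
    let ?Z = "?S \<union> E `` ?S"
    have "?S \<noteq> {}" using out_card[OF uvV(2)] r_pos by auto
    moreover have "?S \<subset> V"
      using out_nbrs_subset uvV short_free unfolding no_short_cycle_iff by blast
    ultimately have "real r + (1 - \<alpha>) * real r \<le> real (card ?Z)"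
      using growth[of ?S] out_card[OF uvV(2)] by simp
    moreover have "?Z \<subseteq> V" using E_subset by blast
    moreover have "?Z \<inter> ?I = {}"
      using uv short_free unfolding no_short_cycle_iff by blast
    ultimately show ?thesis
      using True by (intro that[of ?Z]) (simp_all add: algebra_simps)
  next
    case False
    let ?S = "out_nbrs u \<inter> out_nbrs v"
    let ?S' = "?S \<union> E `` ?S"
    let ?Z = "?S' \<union> E `` ?S'"
    \<comment> \<open>The second growth step requires \<open>?S'\<close> to be a proper subset, and
      \<open>u\<close> is a vertex it misses.\<close>
    have "u \<notin> ?S'" using short_free unfolding no_short_cycle_iff by blast
    then have "?S' \<subset> V" using E_subset uvV by blast
    have "real r * (2 - \<alpha>) + (1 - \<alpha>)\<^sup>2 * real (card ?S) \<le> real (card ?Z)"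
      using growth_twice[of ?S ?S'] False \<open>?S' \<subset> V\<close> by blast
    moreover have "?Z \<subseteq> V" using E_subset by blast
    \<comment> \<open>Both \<open>u\<close> and \<open>v\<close> reach every vertex of
      \<open>?Z\<close> in at most 3 steps, so an arc back would close a walk of length at most
      4.\<close>
    moreover have "?Z \<inter> ?I = {}"
      using short_free unfolding no_short_cycle_iff by blast
    ultimately show ?thesis by (intro that[of ?Z])
  qed
  have "card Z + card ?I = card (Z \<union> ?I)"
    using Z(2) finite_subset[OF Z(1) finite_V] by (simp add: card_Un_disjoint)
  also have "\<dots> \<le> card V"
    using Z(1) in_nbrs_subset finite_V by (intro card_mono) auto
  finally show ?thesis using Z(3) cI by linarith
qed

section \<open>Averaging over the arcs\<close>

lemma sum_in_card: "(\<Sum>v\<in>V. card (in_nbrs v)) = r * card V"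
  using sum_converse_E[of "\<lambda>_ _. 1::nat"] card_E by simp

text \<open>Grouped by heads, the right-hand side is the sum of the squared indegrees. The mean
  indegree is r, so Cauchy-Schwarz applies.\<close>

lemma sum_arcs_in_card:
  assumes "V \<noteq> {}"
  shows "(real r)\<^sup>2 * real (card V) \<le> (\<Sum>(u, v)\<in>E. real (card (in_nbrs v)))"
proof -
  have "(real r * real (card V))\<^sup>2 = (\<Sum>v\<in>V. real (card (in_nbrs v)))\<^sup>2"
    using sum_in_card by (simp flip: of_nat_sum of_nat_mult)
  also have "\<dots> \<le> real (card V) * (\<Sum>v\<in>V. (real (card (in_nbrs v)))\<^sup>2)"
    using sum_squared_le_sum_of_squares by (simp add: mult.commute)
  also have "(\<Sum>v\<in>V. (real (card (in_nbrs v)))\<^sup>2) = (\<Sum>(u, v)\<in>E. real (card (in_nbrs v)))"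
    by (simp add: sum_converse_E power2_eq_square)
  finally have "real (card V) * ((real r)\<^sup>2 * real (card V))
      \<le> real (card V) * (\<Sum>(u, v)\<in>E. real (card (in_nbrs v)))"
    by (simp add: power2_eq_square algebra_simps)
  then show ?thesis using assms finite_V by (simp add: card_gt_0_iff)
qed

text \<open>Both sides count the induced paths with two arcs, grouped by their last and their first arc.\<close>

lemma sum_induced_paths:
  "(\<Sum>(u, v)\<in>E. card (in_nbrs u - in_nbrs v)) = (\<Sum>(u, v)\<in>E. card (out_nbrs v - out_nbrs u))"
proof -
  have "(\<Sum>(u, v)\<in>E. card (in_nbrs u - in_nbrs v))
      = card (SIGMA e:E. in_nbrs (fst e) - in_nbrs (snd e))"
    by (simp add: case_prod_beta)
  also have "\<dots> = card (SIGMA e:E. out_nbrs (snd e) - out_nbrs (fst e))"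
    by (rule bij_betw_same_card[of "\<lambda>((u, v), x). ((x, u), v)"],
        rule bij_betw_byWitness[where f' = "\<lambda>((x, u), v). ((u, v), x)"]) auto
  also have "\<dots> = (\<Sum>(u, v)\<in>E. card (out_nbrs v - out_nbrs u))"
    by (simp add: case_prod_beta)
  finally show ?thesis .
qed

text \<open>The sum counts the arcs inside the out-neighbourhood of \<open>u\<close>. Without
  2-cycles, these and their reversals are disjoint sets of ordered pairs.\<close>

lemma sum_common_out: "2 * (\<Sum>v\<in>out_nbrs u. common_out u v) \<le> (card (out_nbrs u))\<^sup>2"
proof -
  let ?A = "SIGMA v:out_nbrs u. out_nbrs u \<inter> out_nbrs v"
  have fin: "finite ?A" by auto
  have "?A \<inter> ?A\<inverse> = {}"
    using short_free unfolding no_short_cycle_iff by blast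
  then have "card ?A + card (?A\<inverse>) = card (?A \<union> ?A\<inverse>)"
    using fin by (subst card_Un_disjoint) auto
  also have "\<dots> \<le> card (out_nbrs u \<times> out_nbrs u)"
    by (intro card_mono) auto
  finally show ?thesis
    by (simp add: card_cartesian_product power2_eq_square)
qed

lemma outdegree_bound:
  assumes "V \<noteq> {}" "0 \<le> \<alpha>"
  shows "real r * (4 - 2 * \<alpha> + \<alpha>\<^sup>2 / 2) \<le> real (card V)"
proof -
  define n T where "n = real (card V)" and "T = (\<Sum>(u, v)\<in>E. real (common_out u v))"
  have n_pos: "0 < n" using assms(1) finite_V by (simp add: n_def card_gt_0_iff)
  have cE: "real (card E) = real r * n" by (simp add: n_def card_E)
  have "card (out_nbrs v - out_nbrs u) + common_out u v = r" if "(u, v) \<in> E" for u v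
    using that E_subset out_card[of v]
    by (subst add.commute, subst Int_commute, subst card_Int_Diff[symmetric]) auto
  then have "(\<Sum>(u, v)\<in>E. card (out_nbrs v - out_nbrs u)) + (\<Sum>(u, v)\<in>E. common_out u v) = card E * r"
    by (simp add: case_prod_beta flip: sum.distrib)
  then have "real (\<Sum>(u, v)\<in>E. card (in_nbrs u - in_nbrs v)) + real (\<Sum>(u, v)\<in>E. common_out u v)
      = real (card E * r)"
    unfolding sum_induced_paths by (simp only: flip: of_nat_add)
  then have Q: "(\<Sum>(u, v)\<in>E. real (card (in_nbrs u - in_nbrs v))) = (real r)\<^sup>2 * n - T"
    using cE by (simp add: T_def case_prod_beta power2_eq_square algebra_simps)
  have "(\<Sum>u\<in>V. 2 * (\<Sum>v\<in>out_nbrs u. common_out u v)) \<le> (\<Sum>u\<in>V. r\<^sup>2)"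
  proof (rule sum_mono)
    show "2 * (\<Sum>v\<in>out_nbrs u. common_out u v) \<le> r\<^sup>2" if "u \<in> V" for u
      using sum_common_out[of u] out_card[OF that] by simp
  qed
  then have "2 * (\<Sum>u\<in>V. \<Sum>v\<in>out_nbrs u. common_out u v) \<le> card V * r\<^sup>2"
    by (simp flip: sum_distrib_left)
  then have "real (2 * (\<Sum>u\<in>V. \<Sum>v\<in>out_nbrs u. common_out u v)) \<le> real (card V * r\<^sup>2)"
    by (rule of_nat_mono)
  then have T_le: "2 * T \<le> (real r)\<^sup>2 * n"
    by (simp add: T_def sum_E n_def mult.commute)
  have "(\<Sum>(u, v)\<in>E. real r * (2 - \<alpha>) + (1 - \<alpha>)\<^sup>2 * real (common_out u v)
           + real (card (in_nbrs v)) + real (card (in_nbrs u - in_nbrs v))) \<le> (\<Sum>(u, v)\<in>E. n)"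
    using arc_bound by (intro sum_mono) (auto simp: n_def)
  then have "real r * n * (real r * (2 - \<alpha>)) + (1 - \<alpha>)\<^sup>2 * T
      + (\<Sum>(u, v)\<in>E. real (card (in_nbrs v))) + ((real r)\<^sup>2 * n - T) \<le> real r * n * n"
    using cE unfolding Q[symmetric] unfolding T_def
    by (simp add: case_prod_beta sum.distrib sum_distrib_left)
  \<comment> \<open>The coefficient of \<open>T\<close> is (1 - \<alpha>)^2 - 1 = -\<alpha>(2 -
    \<alpha>). It is not positive, so an upper bound on \<open>T\<close> is what remains to be
    inserted.\<close>
  then have "(real r)\<^sup>2 * n * (4 - \<alpha>) - \<alpha> * (2 - \<alpha>) * T \<le> real r * n * n"
    using sum_arcs_in_card[OF assms(1)] by (simp add: n_def power2_eq_square algebra_simps)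
  moreover have "\<alpha> * (2 - \<alpha>) * (2 * T) \<le> \<alpha> * (2 - \<alpha>) * ((real r)\<^sup>2 * n)"
    using T_le assms(2) alpha_le_1 by (intro mult_left_mono) auto
  ultimately have "(real r * n) * (real r * (4 - 2 * \<alpha> + \<alpha>\<^sup>2 / 2)) \<le> (real r * n) * n"
    by (simp add: power2_eq_square algebra_simps)
  then show ?thesis using n_pos r_pos by (simp add: n_def)
qed

end

section \<open>Reduction to the regular case\<close>

lemma sparse_vertex_exists:
  assumes "no_short_cycle E" "finite V" "V \<noteq> {}"
    and \<alpha>: "0 < \<alpha>" "\<alpha> \<le> 1" "1 < \<alpha> * (4 - 2 * \<alpha> + \<alpha>\<^sup>2 / 2)"
  shows "\<exists>v\<in>V. real (card (E `` {v} \<inter> V)) < \<alpha> * real (card V)"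
  using assms(2,3)
\<comment> \<open>Counting only out-neighbours inside \<open>V\<close> makes the claim one about
  induced subdigraphs, so the induction hypothesis covers every nonempty proper subset.\<close>
proof (induction V rule: finite_psubset_induct)
  case (psubset V)
  show ?case
  proof (rule ccontr)
    assume "\<not> ?thesis"
    then have ge: "\<alpha> * real (card V) \<le> real (card (E `` {v} \<inter> V))" if "v \<in> V" for v
      using that by force
    \<comment> \<open>The least integer outdegree allowed by the negated claim. Trimming each
      out-neighbourhood to r vertices gives regularity; deleting arcs creates no cycles and
      preserves the sparse vertices of proper subsets.\<close>
    define r where "r = nat \<lceil>\<alpha> * real (card V)\<rceil>"
    have n_pos: "0 < card V" using psubset by (simp add: card_gt_0_iff)
    have r: "\<alpha> * real (card V) \<le> real r" "0 < r"
      using n_pos \<alpha> by (auto simp: r_def)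
    have "\<exists>N. N \<subseteq> E `` {v} \<inter> V \<and> card N = r" if "v \<in> V" for v
    proof -
      have "r \<le> card (E `` {v} \<inter> V)" using ge[OF that] by (simp add: r_def ceiling_le_iff)
      then show ?thesis by (meson obtain_subset_with_card_n)
    qed
    then obtain N where N: "\<And>v. v \<in> V \<Longrightarrow> N v \<subseteq> E `` {v} \<inter> V \<and> card (N v) = r" by metis
    define F where "F = (SIGMA v:V. N v)"
    have FE: "F \<subseteq> E" using N by (auto simp: F_def)
    have Fv: "F `` {v} = N v" if "v \<in> V" for v using that by (auto simp: F_def)
    interpret regular_short_cycle_free V F r \<alpha>
    proof
      show "finite V" by fact
      show "F \<subseteq> V \<times> V" using N by (auto simp: F_def)
      show "no_short_cycle F" using no_short_cycle_mono[OF assms(1) FE] .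
      show "card (F `` {v}) = r" if "v \<in> V" for v using that N Fv by simp
      show "\<exists>x\<in>S. real (card (F `` {x} \<inter> S)) \<le> \<alpha> * real (card S)" if S: "S \<subset> V" "S \<noteq> {}" for S
      proof -
        obtain x where x: "x \<in> S" "real (card (E `` {x} \<inter> S)) < \<alpha> * real (card S)"
          using psubset.IH[OF S] by blast
        have "finite S" using finite_subset[of S V] S(1) psubset.hyps by blast
        then have "card (F `` {x} \<inter> S) \<le> card (E `` {x} \<inter> S)"
          using FE by (intro card_mono) auto
        with x show ?thesis by (intro bexI[of _ x]) auto
      qed
      show "0 < r" by fact
      show "\<alpha> \<le> 1" by fact
    qed
    \<comment> \<open>From \<alpha>n \<le> r and rc \<le> n follows \<alpha>c \<le> 1, against the
      assumption on \<alpha>.\<close>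
    let ?c = "4 - 2 * \<alpha> + \<alpha>\<^sup>2 / 2"
    have "0 \<le> ?c" using \<alpha>(2) zero_le_power2[of \<alpha>] by linarith
    then have "\<alpha> * real (card V) * ?c \<le> real r * ?c"
      using r(1) by (rule mult_right_mono[rotated])
    also have "\<dots> \<le> real (card V)"
      using outdegree_bound psubset.prems \<alpha>(1) by simp
    finally have "real (card V) * (\<alpha> * ?c) \<le> real (card V) * 1" by (simp add: algebra_simps)
    then show False using n_pos \<alpha>(3) by (simp del: mult_1_right)
  qed
qed

theorem theorem1p2:
  fixes V :: "'a set" and E :: "('a \<times> 'a) set" and \<alpha> :: real
  assumes "\<alpha> \<ge> 0.28866"
    and "digraph V E"
    and "card V \<ge> 1"
    and "\<forall>v \<in> V. real (outdeg E v) \<ge> \<alpha> * real (card V)"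
  shows "\<exists>cs. is_dicycle V E cs \<and> length cs \<le> 4"
proof (rule ccontr)
  assume "\<not> ?thesis"
  then have "no_short_cycle E" using no_short_cycleI assms(2) by blast
  moreover have "finite V" "V \<noteq> {}" using assms(2,3) by (auto simp: digraph_def)
  \<comment> \<open>The given \<alpha> may exceed 1, so the lemma is applied to the constant itself.
    The root of x(4 - 2x + x^2/2) = 1 is about 0.288654, just below it.\<close>
  ultimately have "\<exists>v\<in>V. real (card (E `` {v} \<inter> V)) < 0.28866 * real (card V)"
    by (rule sparse_vertex_exists) (simp_all add: power2_eq_square)
  then obtain v where v: "v \<in> V" "real (card (E `` {v} \<inter> V)) < 0.28866 * real (card V)"
    by blast
  have "E `` {v} \<inter> V = {w. (v, w) \<in> E}" using assms(2) by (auto simp: digraph_def)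
  then have "card (E `` {v} \<inter> V) = outdeg E v" by (simp add: outdeg_def)
  then have "\<alpha> * real (card V) < 0.28866 * real (card V)"
    using v(2) bspec[OF assms(4) v(1)] by linarith
  then show False using mult_right_mono[OF assms(1), of "real (card V)"] by simp
qed

end
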